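(* Let $K$ be a locally compact homogeneous metric space. There is a Borel non-null locally finite non-negative measure $P$ on $K$ which is invariant under partial isometries defined on open sets of $K$.
   Context: On a metric space $K$ define: $x\leftrightarrow y$ if and only if there are $\varepsilon>0$ and an isometry from the open ball $B(x;\varepsilon)$ onto the open ball $B(y;\varepsilon)$. $K$ is homogeneous if this equivalence relation has only one equivalence class. A partial isometry is an isometry $T$ from an open set $O$ of $K$ onto an open set of $K$ (not required to extend to $K$); $P$ is invariant under $T$ if $P(T(A))=P(A)$ for every Borel set $A\subseteq O$.
   Formalization: In the definition of x↔y the isometry of B(x;ε) onto B(y;ε) is also required to map x to y; without this every bounded space would be homogeneous, and the claim fails for some bounded, countable, locally compact spaces. *)

theory Defs
  imports "HOL-Analysis.Analysis"
begin

text \<open>Isometries from a subset onto a subset; values outside the domain are irrelevant.\<close>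

definition isometry_onto ::
    "('a::metric_space \<Rightarrow> 'b::metric_space) \<Rightarrow> 'a set \<Rightarrow> 'b set \<Rightarrow> bool" where
  "isometry_onto T S S' \<longleftrightarrow> T ` S = S' \<and> (\<forall>x\<in>S. \<forall>y\<in>S. dist (T x) (T y) = dist x y)"

lemma isometry_onto_comp:
  assumes T1: "isometry_onto T1 S S'" and T2: "isometry_onto T2 S' S''"
  shows "isometry_onto (T2 \<circ> T1) S S''"
proof -
  have im: "T1 ` S = S'" "T2 ` S' = S''"
    and iso1: "\<And>u v. u \<in> S \<Longrightarrow> v \<in> S \<Longrightarrow> dist (T1 u) (T1 v) = dist u v"
    and iso2: "\<And>u v. u \<in> S' \<Longrightarrow> v \<in> S' \<Longrightarrow> dist (T2 u) (T2 v) = dist u v"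
    using T1 T2 unfolding isometry_onto_def by blast+
  have "(T2 \<circ> T1) ` S = S''"
    unfolding image_comp[symmetric] im ..
  moreover have "dist ((T2 \<circ> T1) u) ((T2 \<circ> T1) v) = dist u v" if "u \<in> S" "v \<in> S" for u v
  proof -
    have "T1 u \<in> S'" "T1 v \<in> S'" using that im(1) by blast+
    then show ?thesis using iso1[OF that] iso2 by simp
  qed
  ultimately show ?thesis
    unfolding isometry_onto_def by blast
qed

text \<open>
  The isometry between the balls is required to carry centre to centre. Without this the relation
  is not transitive in general, and it is total on every bounded space (take \<open>\<epsilon>\<close> larger than the
  diameter and the identity map).
\<close>

definition locally_isometric :: "('a::metric_space \<times> 'a) set" where
  "locally_isometric =
     {(x, y). \<exists>\<epsilon>>0. \<exists>T. isometry_onto T (ball x \<epsilon>) (ball y \<epsilon>) \<and> T x = y}"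

lemma equiv_locally_isometric: "equiv UNIV (locally_isometric :: ('a::metric_space \<times> 'a) set)"
proof (rule equivI)
  show "refl (locally_isometric :: ('a \<times> 'a) set)"
  proof (rule reflI)
    fix x :: 'a
    have "isometry_onto (\<lambda>u. u) (ball x 1) (ball x 1)"
      by (simp add: isometry_onto_def)
    then show "(x, x) \<in> locally_isometric"
      unfolding locally_isometric_def using zero_less_one by blast
  qed
next
  show "sym (locally_isometric :: ('a \<times> 'a) set)"
  proof (rule symI)
    fix x y :: 'a
    assume "(x, y) \<in> locally_isometric"
    then obtain e T where e: "e > 0" and T: "isometry_onto T (ball x e) (ball y e)" "T x = y"
      unfolding locally_isometric_def by blast
    then have im: "T ` ball x e = ball y e"
      and iso: "\<And>u v. u \<in> ball x e \<Longrightarrow> v \<in> ball x e \<Longrightarrow> dist (T u) (T v) = dist u v"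
      unfolding isometry_onto_def by blast+
    have inj: "inj_on T (ball x e)"
      by (rule inj_onI) (metis iso dist_eq_0_iff)
    define S where "S = inv_into (ball x e) T"
    have ST: "S (T u) = u" if "u \<in> ball x e" for u
      using inj that by (simp add: S_def)
    have "S ` ball y e = ball x e"
      unfolding im[symmetric] image_image using ST by simp
    moreover have "dist (S u) (S v) = dist u v" if uv: "u \<in> ball y e" "v \<in> ball y e" for u v
    proof -
      obtain u' v' where "u' \<in> ball x e" "u = T u'" "v' \<in> ball x e" "v = T v'"
        using uv unfolding im[symmetric] by blast
      then show ?thesis by (simp only: ST iso)
    qed
    moreover have "S y = x"
      using ST[of x] e T(2) by simp
    ultimately show "(y, x) \<in> locally_isometric"
      using e unfolding locally_isometric_def isometry_onto_def by blast
  qed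
next
  show "trans (locally_isometric :: ('a \<times> 'a) set)"
  proof (rule transI)
    have restrict: "isometry_onto T (ball x d) (ball y d)"
      if T: "isometry_onto T (ball x e) (ball y e)" "T x = y" and d: "0 < d" "d \<le> e"
      for T d e and x y :: 'a
    proof -
      have im: "T ` ball x e = ball y e"
        and iso: "\<And>u v. u \<in> ball x e \<Longrightarrow> v \<in> ball x e \<Longrightarrow> dist (T u) (T v) = dist u v"
        using T(1) unfolding isometry_onto_def by blast+
      have x: "x \<in> ball x e" using d by simp
      have "T ` ball x d = ball y d"
      proof (intro equalityI subsetI)
        fix z assume "z \<in> T ` ball x d"
        then obtain u where u: "u \<in> ball x d" "z = T u" by blast
        moreover from u(1) have "u \<in> ball x e" using d(2) by simp
        ultimately show "z \<in> ball y d" using iso[OF x] T(2) by simp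
      next
        fix z assume z: "z \<in> ball y d"
        then have "z \<in> ball y e" using d(2) by simp
        then obtain u where u: "u \<in> ball x e" "z = T u" unfolding im[symmetric] by blast
        then have "u \<in> ball x d" using z iso[OF x] T(2) by simp
        then show "z \<in> T ` ball x d" using u(2) by blast
      qed
      moreover have "ball x d \<subseteq> ball x e" using d(2) by (rule subset_ball)
      ultimately show ?thesis using iso unfolding isometry_onto_def by blast
    qed
    fix x y z :: 'a
    assume "(x, y) \<in> locally_isometric" "(y, z) \<in> locally_isometric"
    then obtain e1 T1 e2 T2 where
      1: "e1 > 0" "isometry_onto T1 (ball x e1) (ball y e1)" "T1 x = y" and
      2: "e2 > 0" "isometry_onto T2 (ball y e2) (ball z e2)" "T2 y = z"
      unfolding locally_isometric_def by blast
    define d where "d = min e1 e2"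
    have d: "0 < d" "d \<le> e1" "d \<le> e2" using 1 2 by (auto simp: d_def)
    have "isometry_onto T1 (ball x d) (ball y d)" "isometry_onto T2 (ball y d) (ball z d)"
      using restrict[OF 1(2,3) d(1,2)] restrict[OF 2(2,3) d(1,3)] by this+
    then have "isometry_onto (T2 \<circ> T1) (ball x d) (ball z d)"
      by (rule isometry_onto_comp)
    moreover have "(T2 \<circ> T1) x = z" using 1(3) 2(3) by simp
    ultimately show "(x, z) \<in> locally_isometric"
      using d(1) unfolding locally_isometric_def by blast
  qed
qed simp

definition homogeneous_space :: "'a::metric_space itself \<Rightarrow> bool" where
  "homogeneous_space _ \<longleftrightarrow> is_singleton ((UNIV :: 'a set) // locally_isometric)"

lemma homogeneous_space_iff:
  "homogeneous_space TYPE('a::metric_space) \<longleftrightarrow> (\<forall>x y :: 'a. (x, y) \<in> locally_isometric)"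
proof
  assume "homogeneous_space TYPE('a)"
  then obtain C where C: "(UNIV :: 'a set) // locally_isometric = {C}"
    unfolding homogeneous_space_def is_singleton_def by blast
  show "\<forall>x y :: 'a. (x, y) \<in> locally_isometric"
  proof (intro allI)
    fix x y :: 'a
    have "locally_isometric `` {x} \<in> {C}" "locally_isometric `` {y} \<in> {C}"
      unfolding C[symmetric] by (rule quotientI, rule UNIV_I)+
    then have "locally_isometric `` {x} = locally_isometric `` {y}"
      by simp
    then show "(x, y) \<in> locally_isometric"
      using eq_equiv_class_iff[OF equiv_locally_isometric, of x y] by simp
  qed
next
  assume "\<forall>x y :: 'a. (x, y) \<in> locally_isometric"
  then have "locally_isometric `` {x} = UNIV" for x :: 'a
    by blast
  then have "(UNIV :: 'a set) // locally_isometric = {UNIV}"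
    by (simp add: quotient_def)
  then show "homogeneous_space TYPE('a)"
    by (simp add: homogeneous_space_def)
qed

definition partial_isometry :: "('a::metric_space \<Rightarrow> 'a) \<Rightarrow> 'a set \<Rightarrow> bool" where
  "partial_isometry T U \<longleftrightarrow> open U \<and> (\<exists>V. open V \<and> isometry_onto T U V)"

text \<open>
  Images of Borel subsets of \<open>U\<close> under a partial isometry on \<open>U\<close> are Borel, so the left-hand side
  below never falls back to the default value of \<^const>\<open>emeasure\<close> on non-measurable sets.
\<close>

definition invariant_under :: "'a::metric_space measure \<Rightarrow> ('a \<Rightarrow> 'a) \<Rightarrow> 'a set \<Rightarrow> bool" where
  "invariant_under P T U \<longleftrightarrow> (\<forall>A\<in>sets borel. A \<subseteq> U \<longrightarrow> emeasure P (T ` A) = emeasure P A)"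

definition locally_finite_measure :: "'a::topological_space measure \<Rightarrow> bool" where
  "locally_finite_measure P \<longleftrightarrow> (\<forall>x. \<exists>U. open U \<and> x \<in> U \<and> emeasure P U < \<infinity>)"

end

theory Submission
  imports Defs
begin

text \<open>
  The supremum of the cardinalities of the finite \<open>r\<close>-separated subsets of \<open>S\<close> depends only on the metric of
  \<open>S\<close>, so it is invariant under all isometries between subsets; it is subadditive, and additive
  on sets at distance at least \<open>r\<close>. Divide it by its value on a fixed compact neighbourhood \<open>C\<close>,
  and let \<open>r\<close> tend to \<open>0\<close> along a cluster point. Covering by open sets turns the resulting
  content into an outer measure that is additive on separated sets, hence a measure on the Borel
  sets by Caratheodory's criterion. Since \<open>C\<close> is compact, its countable open covers have finite
  subcovers, which forces \<open>C\<close> to have positive measure; by homogeneity every point has a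
  ball that is isometric to a subset of \<open>C\<close>, which gives local finiteness. No countability of \<open>K\<close> is
  needed: sets without a countable open cover of finite total content get measure \<open>\<infinity>\<close>.
\<close>

text \<open>The explicit gap \<delta> avoids any convention for the distance to an empty set. For
  outer measures this is the hypothesis of Caratheodory's criterion.\<close>

definition metric_superadditive :: "('a::metric_space set \<Rightarrow> ennreal) \<Rightarrow> bool" where
  "metric_superadditive f \<longleftrightarrow>
     (\<forall>A B. \<forall>\<delta>>0. (\<forall>a\<in>A. \<forall>b\<in>B. \<delta> \<le> dist a b) \<longrightarrow> f A + f B \<le> f (A \<union> B))"

lemma metric_superadditiveI:
  assumes "\<And>A B \<delta>. \<delta> > 0 \<Longrightarrow> (\<And>a b. a \<in> A \<Longrightarrow> b \<in> B \<Longrightarrow> \<delta> \<le> dist a b) \<Longrightarrow> f A + f B \<le> f (A \<union> B)"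
  shows "metric_superadditive f"
  unfolding metric_superadditive_def using assms by blast

lemma metric_superadditiveD:
  assumes "metric_superadditive f" "\<delta> > 0" "\<And>a b. a \<in> A \<Longrightarrow> b \<in> B \<Longrightarrow> \<delta> \<le> dist a b"
  shows "f A + f B \<le> f (A \<union> B)"
  using assms unfolding metric_superadditive_def by blast

section \<open>Packing numbers\<close>

definition separated :: "real \<Rightarrow> 'a::metric_space set \<Rightarrow> bool" where
  "separated r F \<longleftrightarrow> (\<forall>x\<in>F. \<forall>y\<in>F. x \<noteq> y \<longrightarrow> r \<le> dist x y)"

definition packing_number :: "real \<Rightarrow> 'a::metric_space set \<Rightarrow> ennreal" where
  "packing_number r S = (SUP F\<in>{F. finite F \<and> F \<subseteq> S \<and> separated r F}. of_nat (card F))"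

lemma card_le_packing_number:
  "finite F \<Longrightarrow> F \<subseteq> S \<Longrightarrow> separated r F \<Longrightarrow> of_nat (card F) \<le> packing_number r S"
  unfolding packing_number_def by (rule SUP_upper) auto

lemma packing_number_le:
  assumes "\<And>F. finite F \<Longrightarrow> F \<subseteq> S \<Longrightarrow> separated r F \<Longrightarrow> of_nat (card F) \<le> c"
  shows "packing_number r S \<le> c"
  unfolding packing_number_def by (rule SUP_least) (use assms in auto)

lemma separated_subset: "separated r F \<Longrightarrow> G \<subseteq> F \<Longrightarrow> separated r G"
  unfolding separated_def by blast

lemma packing_number_empty: "packing_number r ({} :: 'a::metric_space set) = 0"
proof -
  have "packing_number r ({} :: 'a set) \<le> 0"
    by (rule packing_number_le) simp
  then show ?thesis by simp
qed

lemma packing_number_mono: "A \<subseteq> B \<Longrightarrow> packing_number r A \<le> packing_number r B"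
  by (rule packing_number_le) (blast intro: card_le_packing_number)

lemma packing_number_Un_le: "packing_number r (A \<union> B) \<le> packing_number r A + packing_number r B"
proof (rule packing_number_le)
  fix F assume F: "finite F" "F \<subseteq> A \<union> B" "separated r F"
  have "card F \<le> card (F \<inter> A) + card (F \<inter> B)"
    using card_Un_le[of "F \<inter> A" "F \<inter> B"] F(2) by (metis Int_Un_distrib inf.absorb1)
  then have "(of_nat (card F) :: ennreal) \<le> of_nat (card (F \<inter> A)) + of_nat (card (F \<inter> B))"
    by (metis of_nat_add of_nat_mono)
  also have "\<dots> \<le> packing_number r A + packing_number r B"
    using F by (intro add_mono card_le_packing_number) (auto intro: separated_subset)
  finally show "of_nat (card F) \<le> packing_number r A + packing_number r B" .
qed

lemma packing_number_Un_ge: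
  assumes "\<And>a b. a \<in> A \<Longrightarrow> b \<in> B \<Longrightarrow> r \<le> dist a b" and "r > 0"
  shows "packing_number r A + packing_number r B \<le> packing_number r (A \<union> B)"
proof -
  let ?P = "\<lambda>S. {F. finite F \<and> F \<subseteq> S \<and> separated r F}"
  have ne: "?P S \<noteq> {}" for S
    by (auto simp: separated_def intro!: exI[of _ "{}"])
  have "of_nat (card F) + of_nat (card G) \<le> packing_number r (A \<union> B)"
    if "F \<in> ?P A" "G \<in> ?P B" for F G
  proof -
    \<comment> \<open>A common point would be at distance 0 from itself, against
      \<open>r > 0\<close>.\<close>
    have "F \<inter> G = {}"
      using that assms by force
    then have "of_nat (card F) + of_nat (card G) = (of_nat (card (F \<union> G)) :: ennreal)"
      using that by (simp add: card_Un_disjoint)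
    moreover have "separated r (F \<union> G)"
      using that assms(1) unfolding separated_def
      by (simp add: subset_iff) (metis Un_iff dist_commute)
    ultimately show ?thesis
      using that by (auto intro!: card_le_packing_number)
  qed
  then show ?thesis
    unfolding packing_number_def[of r A] packing_number_def[of r B]
    by (simp only: ennreal_SUP_add_left[OF ne, symmetric] ennreal_SUP_add_right[OF ne])
      (intro SUP_least)
qed

lemma packing_number_isometry_le:
  assumes "isometry_onto T A B"
  shows "packing_number r A \<le> packing_number r B"
proof (rule packing_number_le)
  fix F assume F: "finite F" "F \<subseteq> A" "separated r F"
  have T: "T ` A = B" "\<And>x y. x \<in> A \<Longrightarrow> y \<in> A \<Longrightarrow> dist (T x) (T y) = dist x y"
    using assms unfolding isometry_onto_def by auto
  have "inj_on T F"
    by (rule inj_onI) (metis F(2) T(2) dist_eq_0_iff subsetD)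
  then have "card F = card (T ` F)"
    by (simp add: card_image)
  moreover have "separated r (T ` F)"
    using F T(2) unfolding separated_def by (auto simp: subset_iff)
  ultimately show "of_nat (card F) \<le> packing_number r B"
    using F T(1) by (auto intro!: card_le_packing_number)
qed

lemma packing_number_ge_1:
  assumes "x \<in> S"
  shows "1 \<le> packing_number r S"
  using card_le_packing_number[of "{x}" S r] assms by (simp add: separated_def)

text \<open>Pigeonhole: finitely many balls of radius \<open>r / 2\<close> cover \<open>S\<close>,
  and each holds at most one point of an \<open>r\<close>-separated set.\<close>

lemma packing_number_finite:
  assumes "compact S" "r > 0"
  shows "packing_number r S < top"
proof -
  obtain k where k: "finite k" "S \<subseteq> (\<Union>x\<in>k. ball x (r / 2))"
    using assms compact_eq_totally_bounded half_gt_zero by metis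
  have "packing_number r S \<le> of_nat (card k)"
  proof (rule packing_number_le)
    fix F assume F: "finite F" "F \<subseteq> S" "separated r F"
    have "\<forall>x\<in>F. \<exists>c\<in>k. x \<in> ball c (r / 2)"
      using F k by blast
    then obtain c where c: "\<And>x. x \<in> F \<Longrightarrow> c x \<in> k" "\<And>x. x \<in> F \<Longrightarrow> x \<in> ball (c x) (r / 2)"
      by metis
    have "inj_on c F"
    proof (rule inj_onI, rule ccontr)
      fix x y assume xy: "x \<in> F" "y \<in> F" "c x = c y" "x \<noteq> y"
      then have "dist x y < r"
        using c(2)[of x] c(2)[of y] by (metis dist_commute dist_triangle_half_r mem_ball)
      then show False
        using F(3) xy unfolding separated_def by force
    qed
    then have "card F \<le> card k"
      using c(1) k(1) by (intro card_inj_on_le) auto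
    then show "(of_nat (card F) :: ennreal) \<le> of_nat (card k)"
      by (rule of_nat_mono)
  qed
  then show ?thesis
    using ennreal_of_nat_neq_top[of "card k"] by (metis le_less_trans less_top)
qed

section \<open>The limiting content\<close>

text \<open>Tychonoff's theorem; admitting the value \<infinity> is what makes each factor
  compact.\<close>

lemma compact_UNIV_fun_ennreal: "compact (UNIV :: ('b \<Rightarrow> ennreal) set)"
proof -
  have "compactin (product_topology (\<lambda>_::'b. euclidean :: ennreal topology) UNIV) (PiE UNIV (\<lambda>_. UNIV))"
    unfolding compactin_PiE using compact_UNIV by simp
  then show ?thesis
    by (simp add: euclidean_product_topology)
qed

text \<open>Any cluster point of the sequence, viewed as a filter, will do. A convergent subsequence
  may fail to exist in a product over uncountably many sets.\<close>

lemma compact_sequence_limit_point: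
  fixes X :: "nat \<Rightarrow> 'a::topological_space"
  assumes "compact (UNIV :: 'a set)"
  obtains g where "\<And>Z. closed Z \<Longrightarrow> eventually (\<lambda>n. X n \<in> Z) sequentially \<Longrightarrow> g \<in> Z"
proof -
  let ?F = "filtermap X sequentially"
  have "?F \<noteq> bot" "eventually (\<lambda>x. x \<in> UNIV) ?F"
    by (simp_all add: filtermap_bot_iff)
  then obtain g where g: "inf (nhds g) ?F \<noteq> bot"
    using assms[unfolded compact_filter, rule_format, of ?F] by blast
  have "g \<in> Z" if "closed Z" and ev: "eventually (\<lambda>n. X n \<in> Z) sequentially" for Z
  proof (rule ccontr)
    assume "g \<notin> Z"
    then have "eventually (\<lambda>x. x \<in> - Z) (nhds g)"
      using \<open>closed Z\<close> by (intro eventually_nhds_in_open) auto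
    moreover have "eventually (\<lambda>x. x \<in> Z) ?F"
      using ev by (simp add: eventually_filtermap)
    ultimately have "eventually (\<lambda>_. False) (inf (nhds g) ?F)"
      unfolding eventually_inf by fastforce
    then show False
      using g by (simp add: eventually_False)
  qed
  then show thesis
    by (rule that)
qed

text \<open>A cluster point of the normalized packing numbers in the compact product space of all
  set functions inherits every closed condition that the packing numbers satisfy eventually; unlike
  the upper or the lower limit it is both subadditive and superadditive.\<close>

lemma exists_isometry_invariant_content:
  fixes C :: "'a::metric_space set"
  assumes "compact C" "C \<noteq> {}"
  obtains \<nu> :: "'a set \<Rightarrow> ennreal" where
    "\<nu> {} = 0" "\<nu> C = 1"
    "\<And>A B. A \<subseteq> B \<Longrightarrow> \<nu> A \<le> \<nu> B"
    "\<And>A B. \<nu> (A \<union> B) \<le> \<nu> A + \<nu> B"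
    "metric_superadditive \<nu>"
    "\<And>T A B. isometry_onto T A B \<Longrightarrow> \<nu> A \<le> \<nu> B"
proof -
  define r :: "nat \<Rightarrow> real" where "r n = inverse (real (Suc n))" for n
  define X :: "nat \<Rightarrow> 'a set \<Rightarrow> ennreal"
    where "X n S = packing_number (r n) S / packing_number (r n) C" for n S
  have r: "r n > 0" for n
    by (simp add: r_def)
  obtain \<nu> where \<nu>: "\<And>Z. closed Z \<Longrightarrow> eventually (\<lambda>n. X n \<in> Z) sequentially \<Longrightarrow> \<nu> \<in> Z"
    using compact_sequence_limit_point[OF compact_UNIV_fun_ennreal, of X] by metis
  note cont = continuous_on_add_ennreal continuous_on_product_coordinates continuous_on_const
  \<comment> \<open>Evaluation at a fixed set is continuous on the product, so non-strict
    inequalities between such values are closed conditions.\<close>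
  have le: "\<nu> A \<le> \<nu> B" if "\<And>n. packing_number (r n) A \<le> packing_number (r n) B" for A B
    using \<nu>[of "{g. g A \<le> g B}"] that
    by (simp add: closed_Collect_le X_def divide_right_mono_ennreal)
  show thesis
  proof
    show "\<nu> {} = 0"
      using \<nu>[of "{g. g {} = 0}"] by (simp add: closed_Collect_eq X_def packing_number_empty)
    obtain x where "x \<in> C"
      using assms(2) by blast
    \<comment> \<open>The divisor is nonzero because \<open>C\<close> has a point and finite because
      \<open>C\<close> is compact, so the quotient at \<open>C\<close> is really 1.\<close>
    have "packing_number (r n) C \<noteq> 0" for n
      using packing_number_ge_1[OF \<open>x \<in> C\<close>, of "r n"] by auto
    then have "X n C = 1" for n
      unfolding X_def by (intro ennreal_divide_self packing_number_finite[OF assms(1) r])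
    then show "\<nu> C = 1"
      using \<nu>[of "{g. g C = 1}"] by (simp add: closed_Collect_eq)
    show "\<nu> A \<le> \<nu> B" if "A \<subseteq> B" for A B
      using that by (intro le packing_number_mono)
    show "\<nu> A \<le> \<nu> B" if "isometry_onto T A B" for T A B
      using that by (intro le packing_number_isometry_le)
    show "\<nu> (A \<union> B) \<le> \<nu> A + \<nu> B" for A B
      using \<nu>[of "{g. g (A \<union> B) \<le> g A + g B}"]
      by (simp add: closed_Collect_le cont X_def divide_right_mono_ennreal packing_number_Un_le
          flip: add_divide_distrib_ennreal)
    show "metric_superadditive \<nu>"
    proof (rule metric_superadditiveI)
      fix A B :: "'a set" and \<delta> :: real
      assume \<delta>: "\<delta> > 0" "\<And>a b. a \<in> A \<Longrightarrow> b \<in> B \<Longrightarrow> \<delta> \<le> dist a b"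
      \<comment> \<open>Superadditivity for the gap \<delta> is available only at scales below
        \<delta>, hence only eventually.\<close>
      have "eventually (\<lambda>n. r n < \<delta>) sequentially"
        using LIMSEQ_inverse_real_of_nat \<delta>(1) unfolding r_def by (rule order_tendstoD)
      then have "eventually (\<lambda>n. X n A + X n B \<le> X n (A \<union> B)) sequentially"
      proof eventually_elim
        case (elim n)
        have "r n \<le> dist a b" if "a \<in> A" "b \<in> B" for a b
          using \<delta>(2)[OF that] elim by linarith
        then show ?case
          using r by (simp add: X_def divide_right_mono_ennreal packing_number_Un_ge
            flip: add_divide_distrib_ennreal)
      qed
      then show "\<nu> A + \<nu> B \<le> \<nu> (A \<union> B)"
        using \<nu>[of "{g. g A + g B \<le> g (A \<union> B)}"] by (simp add: closed_Collect_le cont)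
    qed
  qed
qed

section \<open>Metric outer measures\<close>

text \<open>\<open>countably_subadditive\<close> speaks only of disjoint families, so
  \<open>B\<close> is first replaced by \<open>B - A\<close>.\<close>

lemma outer_measure_space_UNIV_Un_le:
  assumes "outer_measure_space UNIV \<mu>"
  shows "\<mu> (A \<union> B) \<le> \<mu> A + \<mu> B"
proof -
  have "positive UNIV \<mu>" "countably_subadditive UNIV \<mu>"
    using assms by (auto simp: outer_measure_space_def)
  then have "subadditive UNIV \<mu>"
    using ring_of_sets.countably_subadditive_subadditive[of UNIV UNIV \<mu>]
      algebra.axioms(1)[OF algebra_Pow[of UNIV]] by (simp add: Pow_UNIV)
  have "\<mu> (A \<union> (B - A)) \<le> \<mu> A + \<mu> (B - A)"
    using \<open>subadditive UNIV \<mu>\<close> by (intro subadditiveD) auto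
  also have "\<dots> \<le> \<mu> A + \<mu> B"
    using assms by (intro add_mono) (auto simp: outer_measure_space_def intro: increasingD)
  finally show ?thesis by simp
qed

lemma outer_measure_space_UNIV_UN_le:
  assumes \<mu>: "outer_measure_space UNIV \<mu>"
  shows "\<mu> (\<Union>i. A i) \<le> (\<Sum>i::nat. \<mu> (A i))"
proof -
  have "\<mu> (\<Union>i. disjointed A i) \<le> (\<Sum>i. \<mu> (disjointed A i))"
    using \<mu> disjoint_family_disjointed[of A]
    unfolding outer_measure_space_def countably_subadditive_def by blast
  also have "\<dots> \<le> (\<Sum>i. \<mu> (A i))"
    using \<mu> by (intro suminf_le) (auto simp: outer_measure_space_def intro: increasingD[OF _ disjointed_subset])
  finally show ?thesis
    by (simp add: UN_disjointed_eq)
qed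

text \<open>The distance shells \<open>R i\<close> around \<open>F\<close> with indices of equal parity are separated, so their
  outer measures have a finite sum \<open>s\<close>; adding \<open>s\<close> to both sides of the desired
  inequality replaces an argument about its tails.\<close>

lemma metric_outer_measure_closed:
  fixes \<mu> :: "'a::metric_space set \<Rightarrow> ennreal"
  assumes \<mu>: "outer_measure_space UNIV \<mu>"
    and sep: "metric_superadditive \<mu>"
    and F: "closed F" "F \<noteq> {}"
  shows "\<mu> (E \<inter> F) + \<mu> (E - F) \<le> \<mu> E"
proof (cases "\<mu> E = top")
  case False
  have mono: "\<mu> A \<le> \<mu> B" if "A \<subseteq> B" for A B
    using \<mu> that by (auto simp: outer_measure_space_def intro: increasingD)
  \<comment> \<open>\<open>infdist\<close> is 1-Lipschitz, so a gap \<open>t - s\<close> between its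
    levels is a gap between the sets.\<close>
  have sep': "\<mu> A + \<mu> B \<le> \<mu> (A \<union> B)"
    if "s < t" "\<And>a. a \<in> A \<Longrightarrow> t \<le> infdist a F" "\<And>b. b \<in> B \<Longrightarrow> infdist b F \<le> s" for A B s t
  proof (rule metric_superadditiveD[OF sep, of "t - s"])
    fix a b assume "a \<in> A" "b \<in> B"
    then show "t - s \<le> dist a b"
      using that(2)[of a] that(3)[of b] infdist_triangle[of a F b] by linarith
  qed (use that(1) in simp)
  define h :: "nat \<Rightarrow> real" where "h i = inverse (real (Suc i))" for i
  have h: "h i < h j" if "j < i" for i j
    using that by (simp add: h_def)
  have hle: "h i \<le> h j" if "j \<le> i" for i j
    using that by (simp add: h_def)
  have hpos: "h i > 0" for i
    by (simp add: h_def)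
  define G where "G i = {x\<in>E. h i \<le> infdist x F}" for i
  define R where "R i = {x\<in>E. h (Suc i) \<le> infdist x F \<and> infdist x F < h i}" for i
  have parity: "(\<Sum>k<N. \<mu> (R (2 * k + c))) \<le> \<mu> (\<Union>k<N. R (2 * k + c))" for N c
  proof (induction N)
    case (Suc N)
    have "\<mu> (\<Union>k<N. R (2 * k + c)) + \<mu> (R (2 * N + c))
        \<le> \<mu> ((\<Union>k<N. R (2 * k + c)) \<union> R (2 * N + c))"
    proof (cases N)
      case 0
      then show ?thesis
        using \<mu> by (simp add: outer_measure_space_def positive_def)
    next
      case (Suc M)
      show ?thesis
      \<comment> \<open>With \<open>N = Suc M\<close>, the shell of index
        \<open>2 * M + 1 + c\<close> is skipped; its two bounding levels separate the earlier shells
        from \<open>R (2 * N + c)\<close>.\<close>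
      proof (rule sep'[OF h[of "2 * M + 1 + c" "2 * N + c"]])
        fix a assume "a \<in> (\<Union>k<N. R (2 * k + c))"
        then obtain k where "k < N" "h (Suc (2 * k + c)) \<le> infdist a F"
          by (auto simp: R_def)
        moreover have "h (2 * M + 1 + c) \<le> h (Suc (2 * k + c))"
          using Suc \<open>k < N\<close> by (intro hle) auto
        ultimately show "h (2 * M + 1 + c) \<le> infdist a F"
          by linarith
      qed (auto simp: R_def Suc)
    qed
    also have "(\<Union>k<N. R (2 * k + c)) \<union> R (2 * N + c) = (\<Union>k<Suc N. R (2 * k + c))"
      by (auto simp: less_Suc_eq)
    finally show ?case
      using Suc.IH by (simp add: add_right_mono order_trans[rotated])
  qed (use \<mu> in \<open>simp add: outer_measure_space_def positive_def\<close>)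
  have RE: "(\<Union>k\<in>K. R (j k)) \<subseteq> E" for K :: "nat set" and j
    by (auto simp: R_def)
  \<comment> \<open>The \<open>+ 0\<close> fits the rule that reduces the series to partial sums.
    Even and odd shells contribute at most \<open>\<mu> E\<close> each.\<close>
  have "(\<Sum>i. \<mu> (R i)) + 0 \<le> \<mu> E + \<mu> E"
  proof (rule ennreal_suminf_bound_add)
    fix N
    have "(\<Sum>i<N. \<mu> (R i)) \<le> (\<Sum>i<2 * N. \<mu> (R i))"
      by (rule sum_mono2) auto
    also have "\<dots> = (\<Sum>k<N. \<mu> (R (2 * k + 0))) + (\<Sum>k<N. \<mu> (R (2 * k + 1)))"
      by (induction N) (simp_all add: algebra_simps)
    also have "\<dots> \<le> \<mu> E + \<mu> E"
      by (intro add_mono order_trans[OF parity mono] RE)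
    finally show "(\<Sum>i<N. \<mu> (R i)) + 0 \<le> \<mu> E + \<mu> E" by simp
  qed
  then have fin: "(\<Sum>i. \<mu> (R i)) \<noteq> top"
    using False by (auto simp: top_unique)
  have "(\<Sum>i. \<mu> (R i)) + (\<mu> (E \<inter> F) + \<mu> (E - F)) \<le> \<mu> E + (\<Sum>i. \<mu> (R i))"
  proof (rule ennreal_suminf_bound_add)
    fix N
    have "E - F \<subseteq> G N \<union> (\<Union>i. R (i + N))"
    proof
      fix x assume x: "x \<in> E - F"
      then have "infdist x F > 0"
        using F by (simp add: infdist_pos_not_in_closed)
      then obtain n where n: "h n < infdist x F"
        unfolding h_def by (rule reals_Archimedean[THEN exE])
      show "x \<in> G N \<union> (\<Union>i. R (i + N))"
      proof (cases "h N \<le> infdist x F")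
        case False
        \<comment> \<open>As \<open>h\<close> decreases to 0, the least such \<open>m\<close> places
          \<open>x\<close> in the shell of index \<open>m - 1\<close>, which is at least
          \<open>N\<close>.\<close>
        define m where "m = (LEAST n. h n \<le> infdist x F)"
        have m: "h m \<le> infdist x F"
          unfolding m_def using LeastI[of "\<lambda>n. h n \<le> infdist x F" n] n by simp
        then have "N < m"
          using False hle[of m N] by (cases "N < m") auto
        then obtain i where i: "m = Suc (i + N)"
          by (metis add.commute less_iff_Suc_add)
        have "\<not> h (i + N) \<le> infdist x F"
          using not_less_Least[of "i + N" "\<lambda>n. h n \<le> infdist x F"] i m_def by simp
        then show ?thesis
          using m i x by (auto simp: R_def)
      qed (use x in \<open>simp add: G_def\<close>)
    qed
    then have "\<mu> (E - F) \<le> \<mu> (G N \<union> (\<Union>i. R (i + N)))"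
      by (rule mono)
    also have "\<dots> \<le> \<mu> (G N) + \<mu> (\<Union>i. R (i + N))"
      by (rule outer_measure_space_UNIV_Un_le[OF \<mu>])
    also have "\<dots> \<le> \<mu> (G N) + (\<Sum>i. \<mu> (R (i + N)))"
      by (intro add_left_mono outer_measure_space_UNIV_UN_le \<mu>)
    finally have "\<mu> (E - F) \<le> \<mu> (G N) + (\<Sum>i. \<mu> (R (i + N)))" .
    moreover have "\<mu> (G N) + \<mu> (E \<inter> F) \<le> \<mu> E"
    proof -
      have "\<mu> (G N) + \<mu> (E \<inter> F) \<le> \<mu> (G N \<union> (E \<inter> F))"
        by (rule sep'[OF hpos[of N]]) (auto simp: G_def)
      also have "\<dots> \<le> \<mu> E"
        by (rule mono) (auto simp: G_def)
      finally show ?thesis .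
    qed
    \<comment> \<open>The first \<open>N\<close> shells complete the tail to the full series, so the
      final bound does not depend on \<open>N\<close>.\<close>
    ultimately have "(\<Sum>i<N. \<mu> (R i)) + (\<mu> (E \<inter> F) + \<mu> (E - F))
        \<le> (\<mu> (G N) + \<mu> (E \<inter> F)) + ((\<Sum>i. \<mu> (R (i + N))) + (\<Sum>i<N. \<mu> (R i)))"
    proof -
      have "(\<Sum>i<N. \<mu> (R i)) + (\<mu> (E \<inter> F) + \<mu> (E - F))
          \<le> (\<Sum>i<N. \<mu> (R i)) + (\<mu> (E \<inter> F) + (\<mu> (G N) + (\<Sum>i. \<mu> (R (i + N)))))"
        by (intro add_left_mono) fact
      then show ?thesis by (simp add: ac_simps)
    qed
    also have "\<dots> \<le> \<mu> E + ((\<Sum>i. \<mu> (R (i + N))) + (\<Sum>i<N. \<mu> (R i)))"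
      by (rule add_right_mono) fact
    also have "(\<Sum>i. \<mu> (R (i + N))) + (\<Sum>i<N. \<mu> (R i)) = (\<Sum>i. \<mu> (R i))"
      by (simp add: suminf_offset[of "\<lambda>i. \<mu> (R i)" N] add.commute)
    finally show "(\<Sum>i<N. \<mu> (R i)) + (\<mu> (E \<inter> F) + \<mu> (E - F)) \<le> \<mu> E + (\<Sum>i. \<mu> (R i))" .
  qed
  then show ?thesis
    using fin by (simp add: add.commute[of "\<mu> E"] ennreal_add_left_cancel_le)
qed simp

text \<open>The sets that split every set additively form a sigma-algebra on which \<mu> is a
  measure. It contains the closed sets, hence all Borel sets.\<close>

lemma metric_outer_measure_borel:
  fixes \<mu> :: "'a::metric_space set \<Rightarrow> ennreal"
  assumes \<mu>: "outer_measure_space UNIV \<mu>"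
    and sep: "metric_superadditive \<mu>"
  shows "measure_space UNIV (sets borel) \<mu>"
proof -
  interpret P: sigma_algebra "UNIV :: 'a set" UNIV
    using sigma_algebra_Pow[of "UNIV :: 'a set"] by (simp add: Pow_UNIV)
  let ?L = "lambda_system UNIV UNIV \<mu>"
  have L: "measure_space UNIV ?L \<mu>"
    by (rule P.caratheodory_lemma[OF \<mu>])
  then interpret L: sigma_algebra UNIV ?L
    by (simp add: measure_space_def)
  have "F \<in> ?L" if "closed F" for F
  \<comment> \<open>\<open>infdist\<close> to the empty set is 0 by convention, so the shell
    argument does not cover this case.\<close>
  proof (cases "F = {}")
    case False
    have "\<mu> (E \<inter> F) + \<mu> (E - F) = \<mu> E" for E
    proof (rule antisym)
      show "\<mu> (E \<inter> F) + \<mu> (E - F) \<le> \<mu> E"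
        by (rule metric_outer_measure_closed[OF \<mu> sep that False])
      show "\<mu> E \<le> \<mu> (E \<inter> F) + \<mu> (E - F)"
        using outer_measure_space_UNIV_Un_le[OF \<mu>, of "E \<inter> F" "E - F"] by (simp add: Int_Diff_Un)
    qed
    then show ?thesis
      by (simp add: P.lambda_system_eq)
  qed simp
  then have "sigma_sets UNIV (Collect closed) \<subseteq> ?L"
    by (intro L.sigma_sets_subset) auto
  then have "sets borel \<subseteq> ?L"
    by (simp add: borel_eq_closed)
  then show ?thesis
    using L sets.sigma_algebra_axioms[of "borel :: 'a measure"]
    by (auto simp: measure_space_def positive_def countably_additive_def)
qed

section \<open>The outer measure of a content\<close>

text \<open>Passing to open supersets allows the arbitrary covers in \<open>outer_measure\<close> to
  be enlarged to open covers, to which compactness applies.\<close>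

definition open_hull :: "('a::topological_space set \<Rightarrow> ennreal) \<Rightarrow> 'a set \<Rightarrow> ennreal" where
  "open_hull \<nu> E = (INF V\<in>{V. open V \<and> E \<subseteq> V}. \<nu> V)"

lemma open_hull_le: "open V \<Longrightarrow> E \<subseteq> V \<Longrightarrow> open_hull \<nu> E \<le> \<nu> V"
  unfolding open_hull_def by (rule INF_lower) simp

lemma le_open_hull: "(\<And>V. open V \<Longrightarrow> E \<subseteq> V \<Longrightarrow> c \<le> \<nu> V) \<Longrightarrow> c \<le> open_hull \<nu> E"
  unfolding open_hull_def by (rule INF_greatest) simp

lemma open_hull_less: "open_hull \<nu> E < c \<Longrightarrow> \<exists>V. open V \<and> E \<subseteq> V \<and> \<nu> V < c"
  unfolding open_hull_def INF_less_iff by auto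

lemma open_hull_mono: "A \<subseteq> B \<Longrightarrow> open_hull \<nu> A \<le> open_hull \<nu> B"
  by (rule le_open_hull) (auto intro: open_hull_le)

lemma open_hull_empty: "\<nu> {} = 0 \<Longrightarrow> open_hull \<nu> {} = 0"
  using open_hull_le[of "{}" "{}" \<nu>] by simp

lemma metric_superadditive_open_hull:
  fixes \<nu> :: "'a::metric_space set \<Rightarrow> ennreal"
  assumes mono: "\<And>A B. A \<subseteq> B \<Longrightarrow> \<nu> A \<le> \<nu> B"
    and sep: "metric_superadditive \<nu>"
  shows "metric_superadditive (open_hull \<nu>)"
proof (rule metric_superadditiveI, rule le_open_hull)
  fix A B V :: "'a set" and \<delta> :: real
  assume "\<delta> > 0" and AB: "\<And>a b. a \<in> A \<Longrightarrow> b \<in> B \<Longrightarrow> \<delta> \<le> dist a b"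
  assume V: "open V" "A \<union> B \<subseteq> V"
  \<comment> \<open>Enlarging both sets by \<open>\<delta> / 3\<close> inside \<open>V\<close> makes
    them open and still leaves a gap of \<open>\<delta> / 3\<close>.\<close>
  let ?N = "\<lambda>S. V \<inter> (\<Union>x\<in>S. ball x (\<delta> / 3))"
  have "open_hull \<nu> A + open_hull \<nu> B \<le> \<nu> (?N A) + \<nu> (?N B)"
    using V \<open>\<delta> > 0\<close> by (intro add_mono open_hull_le) auto
  also have "\<dots> \<le> \<nu> (?N A \<union> ?N B)"
  proof (rule metric_superadditiveD[OF sep, of "\<delta> / 3"])
    fix a b assume "a \<in> ?N A" "b \<in> ?N B"
    then obtain a' b' where "a' \<in> A" "b' \<in> B" "dist a' a < \<delta> / 3" "dist b' b < \<delta> / 3"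
      by auto
    moreover from this have "\<delta> \<le> dist a' b'"
      using AB by blast
    moreover have "dist a' b' \<le> dist a' a + dist a b + dist b' b"
      using dist_triangle[of a' b' a] dist_triangle[of a b' b] by (simp add: dist_commute)
    ultimately show "\<delta> / 3 \<le> dist a b" by linarith
  qed (use \<open>\<delta> > 0\<close> in simp)
  also have "\<dots> \<le> \<nu> V"
    by (rule mono) auto
  finally show "open_hull \<nu> A + open_hull \<nu> B \<le> \<nu> V" .
qed

lemma outer_measure_UNIV_greatest:
  assumes "\<And>A. E \<subseteq> (\<Union>i. A i) \<Longrightarrow> disjoint_family A \<Longrightarrow> c \<le> (\<Sum>i. f (A i))"
  shows "c \<le> outer_measure UNIV f E"
  unfolding outer_measure_def by (rule INF_greatest) (use assms in auto)

lemma ring_of_sets_UNIV: "ring_of_sets UNIV UNIV"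
  using algebra.axioms(1)[OF algebra_Pow[of UNIV]] by (simp add: Pow_UNIV)

text \<open>The infimum in \<open>outer_measure\<close> runs over disjoint covers; monotonicity
  extends the bound to all countable covers.\<close>

lemma outer_measure_UNIV_le:
  assumes "f {} = 0" "\<And>A B. A \<subseteq> B \<Longrightarrow> f A \<le> f B" "E \<subseteq> (\<Union>i. A i)"
  shows "outer_measure UNIV f E \<le> (\<Sum>i. f (A i))"
  using assms by (intro ring_of_sets.outer_measure_le[OF ring_of_sets_UNIV])
    (auto simp: positive_def increasing_def)

text \<open>Each member of a cover of \<open>A \<union> B\<close> is cut into its traces on
  \<open>A\<close> and \<open>B\<close>, which inherit the gap.\<close>

lemma metric_superadditive_outer_measure:
  fixes f :: "'a::metric_space set \<Rightarrow> ennreal"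
  assumes "f {} = 0" and mono: "\<And>A B. A \<subseteq> B \<Longrightarrow> f A \<le> f B"
    and sep: "metric_superadditive f"
  shows "metric_superadditive (outer_measure UNIV f)"
proof (rule metric_superadditiveI, rule outer_measure_UNIV_greatest)
  fix A B :: "'a set" and \<delta> :: real and E :: "nat \<Rightarrow> 'a set"
  assume "\<delta> > 0" and AB: "\<And>a b. a \<in> A \<Longrightarrow> b \<in> B \<Longrightarrow> \<delta> \<le> dist a b"
  assume E: "A \<union> B \<subseteq> (\<Union>i. E i)"
  have "outer_measure UNIV f A + outer_measure UNIV f B
      \<le> (\<Sum>i. f (E i \<inter> A)) + (\<Sum>i. f (E i \<inter> B))"
    using E by (intro add_mono outer_measure_UNIV_le assms) auto
  also have "\<dots> = (\<Sum>i. f (E i \<inter> A) + f (E i \<inter> B))"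
    by (rule suminf_add) auto
  also have "\<dots> \<le> (\<Sum>i. f (E i))"
  proof (intro suminf_le)
    fix i
    have "f (E i \<inter> A) + f (E i \<inter> B) \<le> f (E i \<inter> A \<union> E i \<inter> B)"
      using AB by (intro metric_superadditiveD[OF sep \<open>\<delta> > 0\<close>]) auto
    also have "\<dots> \<le> f (E i)"
      by (rule mono) auto
    finally show "f (E i \<inter> A) + f (E i \<inter> B) \<le> f (E i)" .
  qed auto
  finally show "outer_measure UNIV f A + outer_measure UNIV f B \<le> (\<Sum>i. f (E i))" .
qed

text \<open>A countable cover is enlarged to open sets at total cost \<open>e\<close>. Compactness
  then leaves finitely many of them, for which finite subadditivity suffices.\<close>

lemma outer_measure_open_hull_compact:
  assumes empty: "\<nu> {} = 0" and sub: "\<And>A B. \<nu> (A \<union> B) \<le> \<nu> A + \<nu> B"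
    and mono: "\<And>A B. A \<subseteq> B \<Longrightarrow> \<nu> A \<le> \<nu> B" and "compact C"
  shows "\<nu> C \<le> outer_measure UNIV (open_hull \<nu>) C"
proof (rule outer_measure_UNIV_greatest)
  fix A :: "nat \<Rightarrow> 'a set" assume A: "C \<subseteq> (\<Union>i. A i)"
  show "\<nu> C \<le> (\<Sum>i. open_hull \<nu> (A i))"
  proof (rule ennreal_le_epsilon)
    fix e :: real assume "0 < e" and fin: "(\<Sum>i. open_hull \<nu> (A i)) < top"
    \<comment> \<open>Finiteness of the whole sum makes every term finite, without which the
      inequality could not be strict.\<close>
    then have "open_hull \<nu> (A i) < open_hull \<nu> (A i) + e * (1/2) ^ Suc i" for i
      by (auto simp add: less_top dest!: ennreal_suminf_lessD)
    then have "\<exists>V. open V \<and> A i \<subseteq> V \<and> \<nu> V < open_hull \<nu> (A i) + e * (1/2) ^ Suc i" for i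
      by (rule open_hull_less)
    then obtain V where V: "\<And>i. open (V i)" "\<And>i. A i \<subseteq> V i"
      "\<And>i. \<nu> (V i) < open_hull \<nu> (A i) + e * (1/2) ^ Suc i"
      by metis
    obtain I where I: "finite I" "C \<subseteq> (\<Union>i\<in>I. V i)"
      using compactE_image[OF \<open>compact C\<close>, of UNIV V] V A by (metis UN_mono subset_UNIV order_trans order_refl)
    have "\<nu> C \<le> \<nu> (\<Union>i\<in>I. V i)"
      by (rule mono) fact
    also have "\<dots> \<le> (\<Sum>i\<in>I. \<nu> (V i))"
      using I(1) by induction (auto simp: empty intro: order_trans[OF sub] add_left_mono)
    also have "\<dots> \<le> (\<Sum>i. \<nu> (V i))"
      using I(1) by (intro sum_le_suminf) auto
    also have "\<dots> \<le> (\<Sum>i. open_hull \<nu> (A i) + ennreal e * ennreal ((1/2) ^ Suc i))"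
      using V(3) \<open>0 < e\<close> by (intro suminf_le) (auto simp: less_imp_le simp flip: ennreal_mult)
    also have "\<dots> = (\<Sum>i. open_hull \<nu> (A i)) + (\<Sum>i. ennreal e * ennreal ((1/2) ^ Suc i))"
      by (rule suminf_add[symmetric]) auto
    also have "\<dots> = (\<Sum>i. open_hull \<nu> (A i)) + e"
      unfolding ennreal_suminf_cmult
      by (subst suminf_ennreal_eq[OF zero_le_power power_half_series]) auto
    finally show "\<nu> C \<le> (\<Sum>i. open_hull \<nu> (A i)) + e" .
  qed
qed

section \<open>Invariance under partial isometries\<close>

text \<open>An open superset of the image pulls back to a set that is open in the whole space,
  because \<open>U\<close> is open.\<close>

lemma open_hull_partial_isometry_le:
  fixes T :: "'a::metric_space \<Rightarrow> 'a"
  assumes mono: "\<And>A B. A \<subseteq> B \<Longrightarrow> \<nu> A \<le> \<nu> B"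
    and iso: "\<And>T A B. isometry_onto T A B \<Longrightarrow> \<nu> A \<le> \<nu> B"
    and T: "open U" "isometry_onto T U V" and "A \<subseteq> U"
  shows "open_hull \<nu> A \<le> open_hull \<nu> (T ` A)"
proof (rule le_open_hull)
  fix W assume W: "open W" "T ` A \<subseteq> W"
  have T': "\<And>x y. x \<in> U \<Longrightarrow> y \<in> U \<Longrightarrow> dist (T x) (T y) = dist x y"
    using T(2) by (auto simp: isometry_onto_def)
  have "continuous_on U T"
    unfolding continuous_on_iff using T' by auto
  then have "open (U \<inter> T -` W)"
    using T(1) W(1) by (simp add: continuous_on_open_vimage Int_commute)
  then have "open_hull \<nu> A \<le> \<nu> (U \<inter> T -` W)"
    using W \<open>A \<subseteq> U\<close> by (intro open_hull_le) auto
  also have "\<dots> \<le> \<nu> (T ` (U \<inter> T -` W))"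
    using T' by (intro iso[of T]) (auto simp: isometry_onto_def)
  also have "\<dots> \<le> \<nu> W"
    by (rule mono) auto
  finally show "open_hull \<nu> A \<le> \<nu> W" .
qed

lemma outer_measure_partial_isometry_le:
  fixes T :: "'a::metric_space \<Rightarrow> 'a"
  assumes "f {} = 0" and mono: "\<And>A B. A \<subseteq> B \<Longrightarrow> f A \<le> f B"
    and T: "\<And>A. A \<subseteq> U \<Longrightarrow> f A \<le> f (T ` A)" and "A \<subseteq> U"
  shows "outer_measure UNIV f A \<le> outer_measure UNIV f (T ` A)"
proof (rule outer_measure_UNIV_greatest)
  fix E :: "nat \<Rightarrow> 'a set" assume E: "T ` A \<subseteq> (\<Union>i. E i)"
  have "outer_measure UNIV f A \<le> (\<Sum>i. f (A \<inter> T -` E i))"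
    using E by (intro outer_measure_UNIV_le assms) blast+
  also have "\<dots> \<le> (\<Sum>i. f (E i))"
    using \<open>A \<subseteq> U\<close> by (intro suminf_le order_trans[OF T mono]) auto
  finally show "outer_measure UNIV f A \<le> (\<Sum>i. f (E i))" .
qed

text \<open>The one-sided estimates become equalities when applied to the inverse as well.\<close>

lemma isometry_onto_inv_into:
  assumes "isometry_onto T U V"
  shows "isometry_onto (inv_into U T) V U" and "\<And>A. A \<subseteq> U \<Longrightarrow> inv_into U T ` T ` A = A"
proof -
  have T: "T ` U = V" "\<And>x y. x \<in> U \<Longrightarrow> y \<in> U \<Longrightarrow> dist (T x) (T y) = dist x y"
    using assms by (auto simp: isometry_onto_def)
  have inj: "inj_on T U"
    by (rule inj_onI) (metis T(2) dist_eq_0_iff)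
  then show *: "\<And>A. A \<subseteq> U \<Longrightarrow> inv_into U T ` T ` A = A"
    by (rule inv_into_image_cancel)
  have "inv_into U T ` V = U"
    using *[OF order_refl] T(1) by simp
  moreover have "dist (inv_into U T x) (inv_into U T y) = dist x y" if "x \<in> V" "y \<in> V" for x y
    using that T by (metis f_inv_into_f inv_into_into)
  ultimately show "isometry_onto (inv_into U T) V U"
    by (simp add: isometry_onto_def)
qed

section \<open>Construction of the invariant measure\<close>

theorem theorem14:
  assumes "locally_compact_space (euclidean :: 'a::metric_space topology)"
    and "homogeneous_space TYPE('a)"
  shows "\<exists>P :: 'a measure.
           sets P = sets borel \<and>
           emeasure P UNIV \<noteq> 0 \<and>
           locally_finite_measure P \<and>
           (\<forall>T U. partial_isometry T U \<longrightarrow> invariant_under P T U)"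
proof -
  obtain x0 :: 'a and O0 C where C: "open O0" "compact C" "x0 \<in> O0" "O0 \<subseteq> C"
    using assms(1) unfolding locally_compact_space_def
    by (metis UNIV_I topspace_euclidean compactin_euclidean_iff open_openin)
  obtain r0 where r0: "r0 > 0" "ball x0 r0 \<subseteq> C"
    using C by (meson openE order_trans)
  have "C \<noteq> {}"
    using C(3,4) by auto
  obtain \<nu> :: "'a set \<Rightarrow> ennreal" where empty: "\<nu> {} = 0" and C1: "\<nu> C = 1"
    and mono: "\<And>A B. A \<subseteq> B \<Longrightarrow> \<nu> A \<le> \<nu> B"
    and sub: "\<And>A B. \<nu> (A \<union> B) \<le> \<nu> A + \<nu> B"
    and sep: "metric_superadditive \<nu>"
    and iso: "\<And>T A B. isometry_onto T A B \<Longrightarrow> \<nu> A \<le> \<nu> B"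
    by (rule exists_isometry_invariant_content[OF C(2) \<open>C \<noteq> {}\<close>]) (rule that)
  let ?f = "open_hull \<nu>"
  define \<mu> where "\<mu> = outer_measure UNIV ?f"
  have f: "?f {} = 0" "\<And>A B. A \<subseteq> B \<Longrightarrow> ?f A \<le> ?f B"
    by (simp_all add: open_hull_empty empty open_hull_mono)
  have "outer_measure_space UNIV \<mu>"
    unfolding \<mu>_def
    using ring_of_sets.outer_measure_space_outer_measure[OF ring_of_sets_UNIV, of ?f] f
    by (simp add: Pow_UNIV positive_def increasing_def)
  moreover have "metric_superadditive \<mu>"
    unfolding \<mu>_def
    by (rule metric_superadditive_outer_measure[of ?f, OF f metric_superadditive_open_hull[OF mono sep]])
  ultimately have ms: "measure_space UNIV (sets borel) \<mu>"
    by (rule metric_outer_measure_borel)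
  define P where "P = measure_of UNIV (sets borel) \<mu>"
  have sets_P: "sets P = sets borel"
    unfolding P_def using sets.sigma_sets_eq[of "borel :: 'a measure"] by simp
  \<comment> \<open>\<open>measure_of\<close> would give 0 everywhere if \<mu> were not a measure on
    the Borel sets; \<open>ms\<close> rules this out.\<close>
  have P: "emeasure P A = \<mu> A" if "A \<in> sets borel" for A
    unfolding P_def using ms that sets.sigma_algebra_axioms[of "borel :: 'a measure"]
    by (intro emeasure_measure_of_sigma) (simp_all add: measure_space_def)
  have "1 \<le> \<mu> C"
    unfolding \<mu>_def C1[symmetric] by (rule outer_measure_open_hull_compact[OF empty sub mono C(2)])
  also have "\<mu> C = emeasure P C"
    using C(2) by (simp add: P borel_compact)
  also have "\<dots> \<le> emeasure P UNIV"
    by (rule emeasure_mono) (simp_all add: sets_P)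
  finally have "emeasure P UNIV \<noteq> 0"
    by auto
  moreover have "locally_finite_measure P"
    unfolding locally_finite_measure_def
  proof
    fix x
    have "(x, x0) \<in> locally_isometric"
      using assms(2) homogeneous_space_iff by blast
    then obtain e T where e: "e > 0" and T: "isometry_onto T (ball x e) (ball x0 e)" "T x = x0"
      unfolding locally_isometric_def by blast
    \<comment> \<open>\<open>s \<le> e\<close> keeps the ball in the domain of \<open>T\<close>, and
      \<open>s \<le> r0\<close> sends it into \<open>C\<close>, where the content is at most
      1.\<close>
    define s where "s = min e r0"
    have s: "s > 0" "s \<le> e" "s \<le> r0"
      using e r0 by (auto simp: s_def)
    have T': "\<And>y z. y \<in> ball x e \<Longrightarrow> z \<in> ball x e \<Longrightarrow> dist (T y) (T z) = dist y z"
      using T by (auto simp: isometry_onto_def)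
    \<comment> \<open>The ball covers itself; empty sets pad the cover to a sequence.\<close>
    have "\<mu> (ball x s) \<le> (\<Sum>i. ?f (if i = 0 then ball x s else {}))"
      unfolding \<mu>_def by (rule outer_measure_UNIV_le[of ?f, OF f]) auto
    also have "\<dots> = ?f (ball x s)"
      using f(1) by (subst suminf_finite[of "{0}"]) auto
    also have "\<dots> \<le> \<nu> (ball x s)"
      by (rule open_hull_le) auto
    also have "\<dots> \<le> \<nu> (T ` ball x s)"
      using T' s by (intro iso[of T]) (auto simp: isometry_onto_def)
    also have "\<dots> \<le> \<nu> C"
    proof (rule mono)
      have "T ` ball x s \<subseteq> ball x0 r0"
        using T'[of x] T(2) s e by auto
      then show "T ` ball x s \<subseteq> C"
        using r0 by blast
    qed
    finally have "emeasure P (ball x s) < \<infinity>"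
      by (simp add: P C1 le_less_trans[OF _ ennreal_one_less_top])
    then show "\<exists>U. open U \<and> x \<in> U \<and> emeasure P U < \<infinity>"
      using s(1) by (intro exI[of _ "ball x s"]) auto
  qed
  moreover have "invariant_under P T U" if T: "partial_isometry T U" for T U
    unfolding invariant_under_def
  proof (intro ballI impI)
    fix A assume A: "A \<in> sets borel" "A \<subseteq> U"
    obtain V where UV: "open U" "open V" "isometry_onto T U V"
      using T unfolding partial_isometry_def by blast
    \<comment> \<open>Stated for every \<open>T\<close>, \<open>U\<close>, \<open>V\<close> and
      \<open>A\<close>, since it is applied to both \<open>T\<close> and its inverse.\<close>
    have le: "\<mu> A \<le> \<mu> (T ` A)"
      if "open U" "isometry_onto T U V" "A \<subseteq> U" for T U V A
      unfolding \<mu>_def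
      by (rule outer_measure_partial_isometry_le[of ?f, OF f
            open_hull_partial_isometry_le[OF mono iso that(1,2)] that(3)])
    let ?S = "inv_into U T"
    note S = isometry_onto_inv_into[OF UV(3)]
    have TA: "T ` A \<subseteq> V"
      using A(2) UV(3) by (auto simp: isometry_onto_def)
    have "\<mu> (T ` A) = \<mu> A"
      using le[OF UV(1,3) A(2)] le[OF UV(2) S(1) TA] S(2)[OF A(2)] by simp
    \<comment> \<open>The image is the preimage of \<open>A\<close> under the continuous inverse on
      the open set \<open>V\<close>.\<close>
    moreover have "T ` A \<in> sets borel"
    proof -
      have "continuous_on V ?S"
        using S(1) unfolding continuous_on_iff isometry_onto_def by auto
      then have "?S \<in> borel_measurable (restrict_space borel V)"
        by (rule borel_measurable_continuous_on_restrict)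
      then have "?S -` A \<inter> V \<in> sets borel"
        using A(1) UV(2) by (auto dest!: measurable_sets
            simp: space_restrict_space sets_restrict_space_iff)
      moreover have "?S -` A \<inter> V = T ` A"
      proof (intro equalityI subsetI)
        fix y assume "y \<in> ?S -` A \<inter> V"
        moreover from this have "T (?S y) = y"
          using UV(3) by (simp add: isometry_onto_def f_inv_into_f)
        ultimately show "y \<in> T ` A"
          by (metis IntE imageI vimageE)
      next
        fix y assume y: "y \<in> T ` A"
        then have "?S y \<in> ?S ` T ` A"
          by (rule imageI)
        then show "y \<in> ?S -` A \<inter> V"
          using y TA S(2)[OF A(2)] by auto
      qed
      ultimately show ?thesis by simp
    qed
    ultimately show "emeasure P (T ` A) = emeasure P A"
      using A(1) by (simp add: P)
  qed
  ultimately show ?thesis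
    using sets_P by blast
qed

end
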